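(* Let $n\ge k\ge 0$ be integers and $a,b,c$ real numbers, and write $z=1-x-y$ and $\frac{\partial}{\partial z}=\frac{\partial}{\partial y}-\frac{\partial}{\partial x}$. On the open triangle $\{(x,y):0<x<1,\ 0<y<1-x\}$ the following hold: $$\begin{aligned} -(2k+b+c+1)\tfrac{\partial}{\partial x}\!\left(x^ay^bz^cP_{n,k}^{(a,b,c)}\right)&=x^{a-1}y^bz^{c-1}\Big((k+c)(n-k+1)P_{n+1,k}^{(a-1,b,c-1)}+(k+1)(n-k+a)P_{n+1,k+1}^{(a-1,b,c-1)}\Big),\\ \tfrac{\partial}{\partial y}\!\left(x^ay^bz^cP_{n,k}^{(a,b,c)}\right)&=-(k+1)\,x^ay^{b-1}z^{c-1}P_{n+1,k+1}^{(a,b-1,c-1)},\\ (2k+b+c+1)\tfrac{\partial}{\partial z}\!\left(x^ay^bz^cP_{n,k}^{(a,b,c)}\right)&=x^{a-1}y^{b-1}z^{c}\Big((k+b)(n-k+1)P_{n+1,k}^{(a-1,b-1,c)}-(k+1)(n-k+a)P_{n+1,k+1}^{(a-1,b-1,c)}\Big). \end{aligned}$$ Here, $z$ inside the differentiated expressions stands for the function $1-x-y$ of $(x,y)$.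
   Context: Jacobi polynomials: for an integer $m\ge 0$ and real $\alpha,\beta$, $P_m^{(\alpha,\beta)}(x)=\sum_{s=0}^m\binom{m+\alpha}{m-s}\binom{m+\beta}{s}\left(\frac{x-1}{2}\right)^s\left(\frac{x+1}{2}\right)^{m-s}$ (generalized binomial coefficients). Shifted Jacobi polynomials: $\tilde P_m^{(\alpha,\beta)}(x)=P_m^{(\alpha,\beta)}(2x-1)$. For real $a,b,c$ and integers $n\ge k\ge 0$, at points with $x\ne1$, $$P_{n,k}^{(a,b,c)}(x,y)=\tilde P_{n-k}^{(2k+b+c+1,a)}(x)\,(1-x)^k\,\tilde P_k^{(c,b)}\!\left(\tfrac{y}{1-x}\right).$$ *)

theory Defs
  imports "HOL-Analysis.Analysis"
begin

definition jacobi :: "nat \<Rightarrow> real \<Rightarrow> real \<Rightarrow> real \<Rightarrow> real" where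
  "jacobi m \<alpha> \<beta> x =
     (\<Sum>s\<le>m. ((real m + \<alpha>) gchoose (m - s)) * ((real m + \<beta>) gchoose s)
            * ((x - 1) / 2) ^ s * ((x + 1) / 2) ^ (m - s))"

definition shifted_jacobi :: "nat \<Rightarrow> real \<Rightarrow> real \<Rightarrow> real \<Rightarrow> real" where
  "shifted_jacobi m \<alpha> \<beta> x = jacobi m \<alpha> \<beta> (2 * x - 1)"

(* Meaningful only for k \<le> n (truncated subtraction) and x \<noteq> 1 (division by zero). *)
definition triangle_poly :: "nat \<Rightarrow> nat \<Rightarrow> real \<Rightarrow> real \<Rightarrow> real \<Rightarrow> real \<Rightarrow> real \<Rightarrow> real" where
  "triangle_poly n k a b c x y =
     shifted_jacobi (n - k) (2 * real k + b + c + 1) a x * (1 - x) ^ k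
       * shifted_jacobi k c b (y / (1 - x))"

definition weighted_triangle_poly ::
    "nat \<Rightarrow> nat \<Rightarrow> real \<Rightarrow> real \<Rightarrow> real \<Rightarrow> real \<Rightarrow> real \<Rightarrow> real" where
  "weighted_triangle_poly n k a b c x y =
     x powr a * y powr b * (1 - x - y) powr c * triangle_poly n k a b c x y"

definition partial_x :: "(real \<Rightarrow> real \<Rightarrow> real) \<Rightarrow> real \<Rightarrow> real \<Rightarrow> real" where
  "partial_x F x y = deriv (\<lambda>t. F t y) x"

definition partial_y :: "(real \<Rightarrow> real \<Rightarrow> real) \<Rightarrow> real \<Rightarrow> real \<Rightarrow> real" where
  "partial_y F x y = deriv (\<lambda>t. F x t) y"

(* Not a derivative in a third variable: functions have only the arguments x and y, and
   this is differentiation in the direction (-1, 1), along which 1 - x - y is constant. *)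
definition partial_z :: "(real \<Rightarrow> real \<Rightarrow> real) \<Rightarrow> real \<Rightarrow> real \<Rightarrow> real" where
  "partial_z F x y = partial_y F x y - partial_x F x y"

end

theory Submission
  imports Defs
begin

text \<open>
  With \<open>z = 1 - x - y\<close>, the polynomial \<open>P\<^sub>n\<^sub>,\<^sub>k\<close> is the product of two values of a homogeneous form in two
  variables \<open>p\<close>, \<open>v\<close>, namely at \<open>(x, x - 1)\<close> and at \<open>(y, -z)\<close>. The sign in \<open>v\<close> makes both variables grow
  at the same rate along \<open>p - v = const\<close>. The weighted partial derivatives of the form (Euler-type
  identities) shift one parameter, and three contiguous relations, read off coefficientwise from
  Pascal's rule and absorption, rewrite the derivatives of the product in the required basis.
\<close>

section \<open>Jacobi polynomials as binary forms\<close>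

definition jacobi_coeff :: "nat \<Rightarrow> real \<Rightarrow> real \<Rightarrow> nat \<Rightarrow> real" where
  "jacobi_coeff m \<alpha> \<beta> s = ((real m + \<alpha>) gchoose (m - s)) * ((real m + \<beta>) gchoose s)"

definition jacobi_form :: "nat \<Rightarrow> real \<Rightarrow> real \<Rightarrow> real \<Rightarrow> real \<Rightarrow> real" where
  "jacobi_form m \<alpha> \<beta> p v = (\<Sum>s\<le>m. jacobi_coeff m \<alpha> \<beta> s * p ^ (m - s) * v ^ s)"

text \<open>Partial derivative of \<open>jacobi_form\<close> in \<open>p\<close>; the one in
  \<open>v\<close> is \<open>jacobi_form_deriv m \<beta> \<alpha> v p\<close>, so one definition
  serves both. At \<open>s = m\<close> the truncated exponent is harmless because the factor
  \<open>real (m - s)\<close> vanishes.\<close>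

definition jacobi_form_deriv :: "nat \<Rightarrow> real \<Rightarrow> real \<Rightarrow> real \<Rightarrow> real \<Rightarrow> real" where
  "jacobi_form_deriv m \<alpha> \<beta> p v =
    (\<Sum>s\<le>m. jacobi_coeff m \<alpha> \<beta> s * (real (m - s) * p ^ (m - s - 1)) * v ^ s)"

lemma jacobi_form_homogeneous:
  "r ^ m * jacobi_form m \<alpha> \<beta> p v = jacobi_form m \<alpha> \<beta> (r * p) (r * v)"
proof -
  have "r ^ m * (jacobi_coeff m \<alpha> \<beta> s * p ^ (m - s) * v ^ s)
      = jacobi_coeff m \<alpha> \<beta> s * (r * p) ^ (m - s) * (r * v) ^ s" if "s \<le> m" for s
  proof -
    have "r ^ m = r ^ (m - s) * r ^ s"
      using that by (simp flip: power_add)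
    then show ?thesis
      by (simp add: power_mult_distrib)
  qed
  then show ?thesis
    unfolding jacobi_form_def sum_distrib_left by (intro sum.cong) auto
qed

lemma shifted_jacobi_eq_form: "shifted_jacobi m \<alpha> \<beta> u = jacobi_form m \<alpha> \<beta> u (u - 1)"
proof -
  have "(2 * u - 1 - 1) / 2 = u - 1" "(2 * u - 1 + 1) / 2 = u"
    by (simp_all add: field_simps)
  then show ?thesis
    unfolding shifted_jacobi_def jacobi_def jacobi_form_def jacobi_coeff_def by (simp only: mult_ac)
qed

text \<open>Homogeneity absorbs \<open>(1 - x) ^ k\<close> into the inner factor and clears the
  quotient \<open>y / (1 - x)\<close>, so that only polynomials remain to be differentiated.\<close>

lemma triangle_poly_eq_form:
  assumes "x \<noteq> 1"
  shows "triangle_poly n k a b c x y =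
    jacobi_form (n - k) (2 * real k + b + c + 1) a x (x - 1) * jacobi_form k c b y (y - (1 - x))"
proof -
  have "(1 - x) * (y / (1 - x)) = y" "(1 - x) * (y / (1 - x) - 1) = y - (1 - x)"
    using assms by (simp_all add: field_simps)
  then show ?thesis
    by (simp only: triangle_poly_def shifted_jacobi_eq_form jacobi_form_homogeneous mult.assoc)
qed

text \<open>Reversal of the sum; in homogeneous form this is the reflection
  \<open>P_m^(\<alpha>,\<beta>)(-x) = (-1)^m P_m^(\<beta>,\<alpha>)(x)\<close>. It turns statements
  about \<open>p\<close> into statements about \<open>v\<close>.\<close>

lemma jacobi_form_swap: "jacobi_form m \<alpha> \<beta> p v = jacobi_form m \<beta> \<alpha> v p"
  unfolding jacobi_form_def jacobi_coeff_def
  by (rule sum.reindex_bij_witness[of _ "\<lambda>s. m - s" "\<lambda>s. m - s"]) auto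

lemma jacobi_form_deriv_swap:
  "jacobi_form_deriv m \<beta> \<alpha> v p
    = (\<Sum>s\<le>m. jacobi_coeff m \<alpha> \<beta> s * p ^ (m - s) * (real s * v ^ (s - 1)))"
  unfolding jacobi_form_deriv_def jacobi_coeff_def
  by (rule sum.reindex_bij_witness[of _ "\<lambda>s. m - s" "\<lambda>s. m - s"]) auto

lemma has_real_derivative_jacobi_form:
  assumes "(P has_real_derivative P') (at t)" "(V has_real_derivative V') (at t)"
  shows "((\<lambda>t. jacobi_form m \<alpha> \<beta> (P t) (V t)) has_real_derivative
    jacobi_form_deriv m \<alpha> \<beta> (P t) (V t) * P' + jacobi_form_deriv m \<beta> \<alpha> (V t) (P t) * V') (at t)"
  unfolding jacobi_form_deriv_swap[of m \<beta> \<alpha>]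
  unfolding jacobi_form_def jacobi_form_deriv_def sum_distrib_right sum.distrib[symmetric]
  by (rule DERIV_sum) (auto intro!: derivative_eq_intros assms simp: algebra_simps)

section \<open>Binomial and coefficient identities\<close>

lemma gbinomial_Suc_mult: "(1 + real j) * (r gchoose Suc j) = (r - real j) * (r gchoose j)"
  using gbinomial_mult_1[of r j] by (simp add: algebra_simps)

lemma gbinomial_absorb_upper: "r * (r - 1 gchoose j) = (r - real j) * (r gchoose j)" for r :: real
  using gbinomial_absorb_comp[of r j] by simp

lemma jacobi_coeff_lower_left:
  "s \<le> m \<Longrightarrow> (real m + \<alpha>) * jacobi_coeff m (\<alpha> - 1) \<beta> s
    = (\<alpha> + real s) * ((real m + \<alpha> gchoose (m - s)) * (real m + \<beta> gchoose s))"
  using gbinomial_absorb_upper[of "real m + \<alpha>" "m - s"]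
  by (simp add: jacobi_coeff_def of_nat_diff add_diff_eq mult.assoc[symmetric])

text \<open>Absorption is followed by a step from \<open>s\<close> to \<open>Suc s\<close>, because
  this coefficient will be multiplied by \<open>v\<close> and so lands in position
  \<open>Suc s\<close>.\<close>

lemma jacobi_coeff_lower_right:
  "(real m + \<beta>) * jacobi_coeff m \<alpha> (\<beta> - 1) s
    = (1 + real s) * ((real m + \<alpha> gchoose (m - s)) * (real m + \<beta> gchoose Suc s))"
  using gbinomial_absorb_upper[of "real m + \<beta>" s] gbinomial_Suc_mult[of s "real m + \<beta>"]
  by (simp add: jacobi_coeff_def add_diff_eq mult.left_commute)

text \<open>The operator \<open>\<beta> + p d/dp\<close> scales the term in
  \<open>p ^ (m - s)\<close> by \<open>\<beta> + m - s\<close>, and absorption trades that factor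
  for a lowered \<open>\<beta>\<close>. For \<open>p > 0\<close>, multiplying by
  \<open>p powr (\<beta> - 1)\<close> gives the \<open>p\<close>-derivative of
  \<open>p powr \<beta>\<close> times the form.\<close>

lemma jacobi_form_euler:
  "\<beta> * jacobi_form m \<alpha> \<beta> p v + p * jacobi_form_deriv m \<alpha> \<beta> p v
    = (real m + \<beta>) * jacobi_form m \<alpha> (\<beta> - 1) p v"
proof -
  have "\<beta> * (jacobi_coeff m \<alpha> \<beta> s * p ^ (m - s) * v ^ s)
      + p * (jacobi_coeff m \<alpha> \<beta> s * (real (m - s) * p ^ (m - s - 1)) * v ^ s)
      = (real m + \<beta>) * (jacobi_coeff m \<alpha> (\<beta> - 1) s * p ^ (m - s) * v ^ s)" if "s \<le> m" for s
  proof -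
    have "p * (real (m - s) * p ^ (m - s - 1)) = real (m - s) * p ^ (m - s)"
      by (cases "m - s") auto
    moreover have "(real m + \<beta>) * jacobi_coeff m \<alpha> (\<beta> - 1) s = (real (m - s) + \<beta>) * jacobi_coeff m \<alpha> \<beta> s"
      using gbinomial_absorb_upper[of "real m + \<beta>" s] that
      by (simp add: jacobi_coeff_def of_nat_diff add_diff_eq add_diff_add diff_add_eq mult.left_commute)
    moreover have "\<beta> * (C * X * V) + p * (C * Y * V) = r * (C' * X * V)"
      if "p * Y = N * X" "r * C' = (N + \<beta>) * C" for C C' N V X Y r
      using that by algebra
    ultimately show ?thesis
      by blast
  qed
  then show ?thesis
    unfolding jacobi_form_def jacobi_form_deriv_def sum_distrib_left sum.distrib[symmetric]
    by (intro sum.cong) auto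
qed

text \<open>Multiplication by \<open>v\<close> shifts the index by one and multiplication by
  \<open>p\<close> keeps it, so each end coefficient has a single source. Every contiguous relation
  thus reduces to three coefficient checks.\<close>

lemma homogeneous_sum_Suc:
  fixes f g h :: "nat \<Rightarrow> real"
  assumes "h 0 = f 0" "\<And>s. s < m \<Longrightarrow> h (Suc s) = f (Suc s) + g s" "h (Suc m) = g m"
  shows "(\<Sum>s\<le>Suc m. h s * p ^ (Suc m - s) * v ^ s)
    = p * (\<Sum>s\<le>m. f s * p ^ (m - s) * v ^ s) + v * (\<Sum>s\<le>m. g s * p ^ (m - s) * v ^ s)"
proof -
  have "p * (\<Sum>s\<le>m. f s * p ^ (m - s) * v ^ s) = (\<Sum>s\<le>m. f s * p ^ (Suc m - s) * v ^ s)"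
    by (auto simp: sum_distrib_left Suc_diff_le intro!: sum.cong)
  also have "\<dots> = f 0 * p ^ Suc m + (\<Sum>s<m. f (Suc s) * p ^ (m - s) * v ^ Suc s)"
    by (simp add: sum.atMost_shift)
  finally have "p * (\<Sum>s\<le>m. f s * p ^ (m - s) * v ^ s)
      = f 0 * p ^ Suc m + (\<Sum>s<m. f (Suc s) * p ^ (m - s) * v ^ Suc s)" .
  moreover have "v * (\<Sum>s\<le>m. g s * p ^ (m - s) * v ^ s)
      = (\<Sum>s<m. g s * p ^ (m - s) * v ^ Suc s) + g m * v ^ Suc m"
    by (simp add: sum_distrib_left lessThan_Suc_atMost[symmetric] algebra_simps)
  moreover have "(\<Sum>s\<le>Suc m. h s * p ^ (Suc m - s) * v ^ s)
      = h 0 * p ^ Suc m + (\<Sum>s<m. h (Suc s) * p ^ (m - s) * v ^ Suc s) + h (Suc m) * v ^ Suc m"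
    by (subst sum.atMost_Suc_shift) (simp add: lessThan_Suc_atMost[symmetric])
  moreover have "(\<Sum>s<m. h (Suc s) * p ^ (m - s) * v ^ Suc s)
      = (\<Sum>s<m. f (Suc s) * p ^ (m - s) * v ^ Suc s) + (\<Sum>s<m. g s * p ^ (m - s) * v ^ Suc s)"
    by (simp add: assms(2) algebra_simps flip: sum.distrib)
  ultimately show ?thesis
    using assms(1,3) by simp
qed

lemma less_split_real:
  assumes "s < m"
  obtains j where "m - s = Suc j" "m - Suc s = j" "real m = real s + 1 + real j"
proof
  show "m - s = Suc (m - Suc s)" "real m = real s + 1 + real (m - Suc s)"
    using assms by (auto simp: of_nat_diff)
qed simp

section \<open>Contiguous relations between degrees \<open>m\<close> and
  \<open>m + 1\<close>\<close>

context
  fixes m :: nat and \<alpha> \<beta> p v :: real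
begin

text \<open>Euler's relation for the form of degree \<open>Suc m\<close> on the left: the summands
  are \<open>p\<close> and \<open>v\<close> times its partial derivatives. On coefficients,
  \<open>m + 1\<close> splits as \<open>(j + 1) + (s + 1)\<close>.\<close>

lemma jacobi_form_Suc_lower_both:
  "(real m + 1) * jacobi_form (Suc m) (\<alpha> - 1) (\<beta> - 1) p v
    = p * ((real m + \<alpha>) * jacobi_form m (\<alpha> - 1) \<beta> p v)
      + v * ((real m + \<beta>) * jacobi_form m \<alpha> (\<beta> - 1) p v)"
  unfolding jacobi_form_def sum_distrib_left[of "real m + _"] mult.assoc[symmetric]
proof (rule homogeneous_sum_Suc)
  show "(real m + 1) * jacobi_coeff (Suc m) (\<alpha> - 1) (\<beta> - 1) 0
      = (real m + \<alpha>) * jacobi_coeff m (\<alpha> - 1) \<beta> 0"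
    using gbinomial_Suc_mult[of m "real m + \<alpha>"]
    by (simp add: jacobi_coeff_lower_left) (simp add: jacobi_coeff_def add_ac)
next
  fix s assume "s < m"
  then obtain j where j: "m - s = Suc j" "m - Suc s = j" "real m = real s + 1 + real j"
    by (rule less_split_real)
  have "(1 + real j) * (real m + \<alpha> gchoose Suc j) = (\<alpha> + real (Suc s)) * (real m + \<alpha> gchoose j)"
    using gbinomial_Suc_mult[of j "real m + \<alpha>"] by (simp add: j(3) add_ac)
  moreover have "jacobi_coeff (Suc m) (\<alpha> - 1) (\<beta> - 1) (Suc s)
      = (real m + \<alpha> gchoose Suc j) * (real m + \<beta> gchoose Suc s)"
    by (simp add: jacobi_coeff_def j(1) add_ac)
  ultimately show "(real m + 1) * jacobi_coeff (Suc m) (\<alpha> - 1) (\<beta> - 1) (Suc s)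
      = (real m + \<alpha>) * jacobi_coeff m (\<alpha> - 1) \<beta> (Suc s) + (real m + \<beta>) * jacobi_coeff m \<alpha> (\<beta> - 1) s"
    unfolding jacobi_coeff_lower_left[OF Suc_leI[OF \<open>s < m\<close>]] jacobi_coeff_lower_right j(1,2)
    using j(3) by algebra
next
  show "(real m + 1) * jacobi_coeff (Suc m) (\<alpha> - 1) (\<beta> - 1) (Suc m)
      = (real m + \<beta>) * jacobi_coeff m \<alpha> (\<beta> - 1) m"
    by (simp add: jacobi_coeff_lower_right) (simp add: jacobi_coeff_def add_ac)
qed

text \<open>Pascal's rule splits the binomial with raised \<open>\<alpha>\<close>; what remains is
  the ratio of two consecutive binomials in \<open>m + \<alpha>\<close>.\<close>

lemma jacobi_form_Suc_raise_left:
  "(real m + 1) * jacobi_form (Suc m) (\<alpha> - 1) (\<beta> - 1) p v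
    = p * (\<alpha> * jacobi_form m \<alpha> \<beta> p v)
      + v * ((real m + \<beta>) * jacobi_form m (\<alpha> + 1) (\<beta> - 1) p v)"
  unfolding jacobi_form_def sum_distrib_left[of "real m + _"] sum_distrib_left[of \<alpha>]
    mult.assoc[symmetric]
proof (rule homogeneous_sum_Suc)
  show "(real m + 1) * jacobi_coeff (Suc m) (\<alpha> - 1) (\<beta> - 1) 0 = \<alpha> * jacobi_coeff m \<alpha> \<beta> 0"
    using gbinomial_Suc_mult[of m "real m + \<alpha>"] by (simp add: jacobi_coeff_def add_ac)
next
  fix s assume "s < m"
  then obtain j where j: "m - s = Suc j" "m - Suc s = j" "real m = real s + 1 + real j"
    by (rule less_split_real)
  have "(1 + real j) * (real m + \<alpha> gchoose Suc j) = (\<alpha> + 1 + real s) * (real m + \<alpha> gchoose j)"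
    using gbinomial_Suc_mult[of j "real m + \<alpha>"] by (simp add: j(3) add_ac)
  moreover have "jacobi_coeff (Suc m) (\<alpha> - 1) (\<beta> - 1) (Suc s)
      = (real m + \<alpha> gchoose Suc j) * (real m + \<beta> gchoose Suc s)"
    by (simp add: jacobi_coeff_def j(1) add_ac)
  moreover have "jacobi_coeff m \<alpha> \<beta> (Suc s) = (real m + \<alpha> gchoose j) * (real m + \<beta> gchoose Suc s)"
    by (simp add: jacobi_coeff_def j(2))
  moreover have "real m + (\<alpha> + 1) gchoose Suc j = (real m + \<alpha> gchoose j) + (real m + \<alpha> gchoose Suc j)"
    using gbinomial_Suc_Suc[of "real m + \<alpha>" j] by (simp add: add_ac)
  ultimately show "(real m + 1) * jacobi_coeff (Suc m) (\<alpha> - 1) (\<beta> - 1) (Suc s)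
      = \<alpha> * jacobi_coeff m \<alpha> \<beta> (Suc s) + (real m + \<beta>) * jacobi_coeff m (\<alpha> + 1) (\<beta> - 1) s"
    unfolding jacobi_coeff_lower_right j(1,2)
    using j(3) by algebra
next
  show "(real m + 1) * jacobi_coeff (Suc m) (\<alpha> - 1) (\<beta> - 1) (Suc m)
      = (real m + \<beta>) * jacobi_coeff m (\<alpha> + 1) (\<beta> - 1) m"
    by (simp add: jacobi_coeff_lower_right) (simp add: jacobi_coeff_def add_ac)
qed

text \<open>Here Pascal's rule acts on the binomial in \<open>\<beta>\<close>. For
  \<open>m = k\<close>, \<open>\<alpha> = c\<close>, \<open>\<beta> = b\<close> the constant becomes
  \<open>2k + b + c + 1\<close>, the factor in the theorem.\<close>

lemma jacobi_form_Suc_lower_left: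
  "(real m + 1) * jacobi_form (Suc m) (\<alpha> - 1) \<beta> p v
    = (real m + \<alpha>) * (p - v) * jacobi_form m (\<alpha> - 1) \<beta> p v
      + (2 * real m + \<alpha> + \<beta> + 1) * v * jacobi_form m \<alpha> \<beta> p v"
proof -
  let ?r = "2 * real m + \<alpha> + \<beta> + 1"
  \<comment> \<open>Regrouped as \<open>p\<close> times one form plus \<open>v\<close> times
    another, to compare coefficients.\<close>
  have "(real m + 1) * jacobi_form (Suc m) (\<alpha> - 1) \<beta> p v
    = p * ((real m + \<alpha>) * jacobi_form m (\<alpha> - 1) \<beta> p v)
      + v * (?r * jacobi_form m \<alpha> \<beta> p v - (real m + \<alpha>) * jacobi_form m (\<alpha> - 1) \<beta> p v)"
    unfolding jacobi_form_def sum_distrib_left[of "real m + _"] sum_distrib_left[of ?r]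
      mult.assoc[symmetric] sum_subtractf[symmetric] left_diff_distrib[symmetric]
  proof (rule homogeneous_sum_Suc)
    show "(real m + 1) * jacobi_coeff (Suc m) (\<alpha> - 1) \<beta> 0
        = (real m + \<alpha>) * jacobi_coeff m (\<alpha> - 1) \<beta> 0"
      using gbinomial_Suc_mult[of m "real m + \<alpha>"]
      by (simp add: jacobi_coeff_lower_left) (simp add: jacobi_coeff_def add_ac)
  next
    fix s assume "s < m"
    then obtain j where j: "m - s = Suc j" "m - Suc s = j" "real m = real s + 1 + real j"
      by (rule less_split_real)
    have "(1 + real j) * (real m + \<alpha> gchoose Suc j) = (\<alpha> + real (Suc s)) * (real m + \<alpha> gchoose j)"
      using gbinomial_Suc_mult[of j "real m + \<alpha>"] by (simp add: j(3) add_ac)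
    moreover have "jacobi_coeff (Suc m) (\<alpha> - 1) \<beta> (Suc s)
        = (real m + \<alpha> gchoose Suc j) * ((real m + \<beta> gchoose s) + (real m + \<beta> gchoose Suc s))"
      using gbinomial_Suc_Suc[of "real m + \<beta>" s] by (simp add: jacobi_coeff_def j(1) add_ac)
    moreover have "jacobi_coeff m \<alpha> \<beta> s = (real m + \<alpha> gchoose Suc j) * (real m + \<beta> gchoose s)"
      by (simp add: jacobi_coeff_def j(1))
    ultimately show "(real m + 1) * jacobi_coeff (Suc m) (\<alpha> - 1) \<beta> (Suc s)
        = (real m + \<alpha>) * jacobi_coeff m (\<alpha> - 1) \<beta> (Suc s)
          + (?r * jacobi_coeff m \<alpha> \<beta> s - (real m + \<alpha>) * jacobi_coeff m (\<alpha> - 1) \<beta> s)"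
      unfolding jacobi_coeff_lower_left[OF Suc_leI[OF \<open>s < m\<close>]]
        jacobi_coeff_lower_left[OF less_imp_le[OF \<open>s < m\<close>]] j(1,2)
      using j(3) gbinomial_Suc_mult[of s "real m + \<beta>"] by algebra
  next
    \<comment> \<open>At the top index the factor \<open>m + \<beta> + 1\<close> is exactly
      \<open>?r - (m + \<alpha>)\<close>.\<close>
    have "(1 + real m) * (real m + 1 + \<beta> gchoose Suc m) = (real m + \<beta> + 1) * (real m + \<beta> gchoose m)"
      using gbinomial_absorption[of m "real m + \<beta> + 1"] by (simp add: add_ac)
    then show "(real m + 1) * jacobi_coeff (Suc m) (\<alpha> - 1) \<beta> (Suc m)
        = ?r * jacobi_coeff m \<alpha> \<beta> m - (real m + \<alpha>) * jacobi_coeff m (\<alpha> - 1) \<beta> m"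
      by (simp add: jacobi_coeff_lower_left) (simp add: jacobi_coeff_def algebra_simps)
  qed
  then show ?thesis
    by algebra
qed

end

lemma jacobi_form_Suc_lower_right:
  "(real m + 1) * jacobi_form (Suc m) \<alpha> (\<beta> - 1) p v
    = (2 * real m + \<alpha> + \<beta> + 1) * p * jacobi_form m \<alpha> \<beta> p v
      - (real m + \<beta>) * (p - v) * jacobi_form m \<alpha> (\<beta> - 1) p v"
  using jacobi_form_Suc_lower_left[of m \<beta> \<alpha> v p]
  unfolding jacobi_form_swap[of _ _ _ v p] by algebra

text \<open>Counterpart of \<open>jacobi_form_euler\<close> when \<open>p\<close> and
  \<open>v\<close> grow together, as they do along \<open>(x, x - 1)\<close>; this direction also
  raises \<open>\<alpha>\<close>.\<close>

lemma jacobi_form_diagonal_deriv: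
  assumes "v \<noteq> 0"
  shows "\<beta> * jacobi_form m \<alpha> \<beta> p v
      + p * (jacobi_form_deriv m \<alpha> \<beta> p v + jacobi_form_deriv m \<beta> \<alpha> v p)
    = (real m + \<beta>) * jacobi_form m (\<alpha> + 1) (\<beta> - 1) p v" (is "?L = ?R")
proof -
  \<comment> \<open>The two Euler identities replace the derivatives,
    \<open>jacobi_form_Suc_lower_both\<close> collects the results in degree \<open>m + 1\<close>,
    and \<open>jacobi_form_Suc_raise_left\<close> expands them again.\<close>
  have "v * ?L = v * ?R"
    using jacobi_form_Suc_lower_both[of m \<alpha> \<beta> p v] jacobi_form_Suc_raise_left[of m \<alpha> \<beta> p v]
      jacobi_form_euler[of \<beta> m \<alpha> p v] jacobi_form_euler[of \<alpha> m \<beta> v p]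
    unfolding jacobi_form_swap[of _ _ _ v p] by algebra
  with assms show ?thesis by simp
qed

section \<open>Differentiation on the triangle\<close>

lemma powr_eq_mult_powr_pred: "x > 0 \<Longrightarrow> x powr r = x * x powr (r - 1)" for x :: real
  by (simp add: powr_diff)

theorem corollary2:
  fixes n k :: nat and a b c x y z :: real
  assumes "k \<le> n"
    and "0 < x" "x < 1" "0 < y" "y < 1 - x"
    and "z = 1 - x - y"
  shows "(\<lambda>t. weighted_triangle_poly n k a b c t y) differentiable (at x) \<and>
         (\<lambda>t. weighted_triangle_poly n k a b c x t) differentiable (at y) \<and>
         (- (2 * real k + b + c + 1) * partial_x (weighted_triangle_poly n k a b c) x y =
           x powr (a - 1) * y powr b * z powr (c - 1) *
           ((real k + c) * (real n - real k + 1) * triangle_poly (n + 1) k (a - 1) b (c - 1) x y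
            + (real k + 1) * (real n - real k + a) * triangle_poly (n + 1) (k + 1) (a - 1) b (c - 1) x y)) \<and>
         (partial_y (weighted_triangle_poly n k a b c) x y =
           - (real k + 1) * x powr a * y powr (b - 1) * z powr (c - 1)
           * triangle_poly (n + 1) (k + 1) a (b - 1) (c - 1) x y) \<and>
         ((2 * real k + b + c + 1) * partial_z (weighted_triangle_poly n k a b c) x y =
           x powr (a - 1) * y powr (b - 1) * z powr c *
           ((real k + b) * (real n - real k + 1) * triangle_poly (n + 1) k (a - 1) (b - 1) c x y
            - (real k + 1) * (real n - real k + a) * triangle_poly (n + 1) (k + 1) (a - 1) (b - 1) c x y))"
proof -
  define m where "m = n - k"
  define \<alpha> where "\<alpha> = 2 * real k + b + c + 1"
  define X Y Z where "X = x powr (a - 1)" and "Y = y powr (b - 1)" and "Z = z powr (c - 1)"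
  define J where "J = jacobi_form m \<alpha> a x (x - 1)"
  define J1 where "J1 = jacobi_form m (\<alpha> + 1) (a - 1) x (x - 1)"
  define J2 where "J2 = jacobi_form (Suc m) (\<alpha> - 1) (a - 1) x (x - 1)"
  define Q where "Q = jacobi_form k c b y (- z)"
  define Qb where "Qb = jacobi_form k c (b - 1) y (- z)"
  define Qc where "Qc = jacobi_form k (c - 1) b y (- z)"
  define Jd where "Jd = jacobi_form_deriv m \<alpha> a x (x - 1) + jacobi_form_deriv m a \<alpha> (x - 1) x"
  define Qp where "Qp = jacobi_form_deriv k c b y (- z)"
  define Qv where "Qv = jacobi_form_deriv k b c (- z) y"
  have pos: "x > 0" "y > 0" "z > 0" "x < 1" and z_eq: "y - (1 - x) = - z" "1 - x - y = z"
    using assms by auto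
  \<comment> \<open>With the lowered powers \<open>X\<close>, \<open>Y\<close>, \<open>Z\<close> as
    atoms, all final identities become polynomial.\<close>
  have pows: "x powr a = x * X" "y powr b = y * Y" "z powr c = z * Z"
    unfolding X_def Y_def Z_def using pos by (intro powr_eq_mult_powr_pred; simp)+

  have weighted: "weighted_triangle_poly n k a b c s t
      = s powr a * t powr b * (1 - s - t) powr c
        * (jacobi_form m \<alpha> a s (s - 1) * jacobi_form k c b t (t - (1 - s)))" if "s < 1" for s t
    using that by (simp add: weighted_triangle_poly_def triangle_poly_eq_form m_def \<alpha>_def)

  have J_diag: "a * J + x * Jd = (real m + a) * J1"
    unfolding J_def Jd_def J1_def by (rule jacobi_form_diagonal_deriv) (use pos in simp)
  have Q_p: "b * Q + y * Qp = (real k + b) * Qb"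
    unfolding Q_def Qp_def Qb_def by (rule jacobi_form_euler)
  have Q_v: "c * Q - z * Qv = (real k + c) * Qc"
    using jacobi_form_euler[of c k b "- z" y]
    unfolding Q_def Qv_def Qc_def jacobi_form_swap[of _ _ _ "- z" y] by simp

  \<comment> \<open>Product rule grouped into the Euler combinations above. Along \<open>x\<close>
    the value \<open>z\<close> falls at unit rate, so the argument \<open>- z\<close> contributes
    \<open>+ Qv\<close>.\<close>
  define Fx where "Fx = X * (a * J + x * Jd) * (y * Y) * (z * Z) * Q
      - x * X * J * (y * Y) * Z * (c * Q - z * Qv)"
  define Fy where "Fy = x * X * J * Y * Z * (z * (b * Q + y * Qp) - y * (c * Q - z * Qv))"

  have powr_x: "((\<lambda>t. t powr a) has_real_derivative a * X) (at x)"
    and powr_y: "((\<lambda>t. t powr b) has_real_derivative b * Y) (at y)"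
    using pos by (auto intro: has_real_derivative_powr simp: X_def Y_def)
  have powr_z: "((\<lambda>t. f t powr c) has_real_derivative - (c * Z)) (at s)"
    if "(f has_real_derivative - 1) (at s)" "f s = z" for f and s :: real
    using DERIV_fun_powr[OF that(1), of c] that(2) pos by (simp add: Z_def)
  have form_x: "((\<lambda>t. jacobi_form m \<alpha> a t (t - 1)) has_real_derivative Jd) (at x)"
    by (rule DERIV_cong[OF has_real_derivative_jacobi_form[where P' = 1 and V' = 1]])
      (auto simp: Jd_def intro!: derivative_eq_intros)
  have form_z: "((\<lambda>t. jacobi_form k c b y (y - (1 - t))) has_real_derivative Qv) (at x)"
    by (rule DERIV_cong[OF has_real_derivative_jacobi_form[where P' = 0 and V' = 1]])
      (auto simp: Qv_def z_eq intro!: derivative_eq_intros)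
  have form_y: "((\<lambda>t. jacobi_form k c b t (t - (1 - x))) has_real_derivative Qp + Qv) (at y)"
    by (rule DERIV_cong[OF has_real_derivative_jacobi_form[where P' = 1 and V' = 1]])
      (auto simp: Qp_def Qv_def z_eq intro!: derivative_eq_intros)

  have "((\<lambda>t. t powr a * y powr b * (1 - t - y) powr c
        * (jacobi_form m \<alpha> a t (t - 1) * jacobi_form k c b y (y - (1 - t)))) has_real_derivative Fx) (at x)"
  proof (rule DERIV_cong)
    show "((\<lambda>t. t powr a * y powr b * (1 - t - y) powr c
        * (jacobi_form m \<alpha> a t (t - 1) * jacobi_form k c b y (y - (1 - t)))) has_real_derivative
        ((a * X * y powr b) * (1 - x - y) powr c + - (c * Z) * (x powr a * y powr b))
          * (jacobi_form m \<alpha> a x (x - 1) * jacobi_form k c b y (y - (1 - x)))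
        + (Jd * jacobi_form k c b y (y - (1 - x)) + Qv * jacobi_form m \<alpha> a x (x - 1))
          * (x powr a * y powr b * (1 - x - y) powr c)) (at x)"
      by (intro DERIV_mult DERIV_cmult_right powr_x form_x form_z powr_z)
        (auto simp: z_eq intro!: derivative_eq_intros)
    show "((a * X * y powr b) * (1 - x - y) powr c + - (c * Z) * (x powr a * y powr b))
          * (jacobi_form m \<alpha> a x (x - 1) * jacobi_form k c b y (y - (1 - x)))
        + (Jd * jacobi_form k c b y (y - (1 - x)) + Qv * jacobi_form m \<alpha> a x (x - 1))
          * (x powr a * y powr b * (1 - x - y) powr c) = Fx"
      unfolding z_eq pows J_def[symmetric] Q_def[symmetric] Fx_def by (simp add: algebra_simps)
  qed
  \<comment> \<open>The form representation needs \<open>s < 1\<close>, so the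
    \<open>x\<close>-derivative is transferred on an open half-line around \<open>x\<close>. In the
    \<open>y\<close> direction \<open>x\<close> is fixed and the representation holds for every
    \<open>t\<close>.\<close>
  then have Fx: "((\<lambda>t. weighted_triangle_poly n k a b c t y) has_real_derivative Fx) (at x)"
    by (rule has_field_derivative_transform_within_open[where S = "{..<1}"]) (use pos weighted in auto)

  have "((\<lambda>t. x powr a * t powr b * (1 - x - t) powr c
        * (jacobi_form m \<alpha> a x (x - 1) * jacobi_form k c b t (t - (1 - x)))) has_real_derivative Fy) (at y)"
  proof (rule DERIV_cong)
    show "((\<lambda>t. x powr a * t powr b * (1 - x - t) powr c
        * (jacobi_form m \<alpha> a x (x - 1) * jacobi_form k c b t (t - (1 - x)))) has_real_derivative
        ((x powr a * (b * Y)) * (1 - x - y) powr c + - (c * Z) * (x powr a * y powr b))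
          * (jacobi_form m \<alpha> a x (x - 1) * jacobi_form k c b y (y - (1 - x)))
        + jacobi_form m \<alpha> a x (x - 1) * (Qp + Qv)
          * (x powr a * y powr b * (1 - x - y) powr c)) (at y)"
      by (intro DERIV_mult DERIV_cmult powr_y form_y powr_z)
        (auto simp: z_eq intro!: derivative_eq_intros)
    show "((x powr a * (b * Y)) * (1 - x - y) powr c + - (c * Z) * (x powr a * y powr b))
          * (jacobi_form m \<alpha> a x (x - 1) * jacobi_form k c b y (y - (1 - x)))
        + jacobi_form m \<alpha> a x (x - 1) * (Qp + Qv)
          * (x powr a * y powr b * (1 - x - y) powr c) = Fy"
      unfolding z_eq pows J_def[symmetric] Q_def[symmetric] Fy_def by (simp add: algebra_simps)
  qed
  then have Fy: "((\<lambda>t. weighted_triangle_poly n k a b c x t) has_real_derivative Fy) (at y)"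
    using pos by (simp add: weighted)

  have partials: "partial_x (weighted_triangle_poly n k a b c) x y = Fx"
    "partial_y (weighted_triangle_poly n k a b c) x y = Fy"
    "partial_z (weighted_triangle_poly n k a b c) x y = Fy - Fx"
    unfolding partial_x_def partial_y_def partial_z_def
    using DERIV_imp_deriv[OF Fx] DERIV_imp_deriv[OF Fy] by simp_all
  have nk: "n + 1 - k = Suc m" "n + 1 - (k + 1) = m" "real n - real k = real m"
    using assms by (auto simp: m_def of_nat_diff Suc_diff_le)
  note triangle = triangle_poly_eq_form[OF less_imp_neq[OF \<open>x < 1\<close>]] z_eq nk

  \<comment> \<open>Raising \<open>k\<close> adds 2 to the outer parameter and lowering
    \<open>b\<close> or \<open>c\<close> subtracts 1. This gives \<open>\<alpha> - 1\<close> in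
    \<open>J2\<close> and \<open>\<alpha> + 1\<close> in \<open>J1\<close>; lowering both restores
    \<open>\<alpha>\<close>, hence \<open>J\<close> in \<open>Ty\<close>.\<close>
  have Tx: "triangle_poly (n + 1) k (a - 1) b (c - 1) x y = J2 * Qc"
    "triangle_poly (n + 1) (k + 1) (a - 1) b (c - 1) x y = J1 * jacobi_form (Suc k) (c - 1) b y (- z)"
    unfolding triangle J1_def J2_def Qc_def by (simp_all add: \<alpha>_def algebra_simps)
  have Ty: "triangle_poly (n + 1) (k + 1) a (b - 1) (c - 1) x y
      = J * jacobi_form (Suc k) (c - 1) (b - 1) y (- z)"
    unfolding triangle J_def by (simp add: \<alpha>_def algebra_simps)
  have Tz: "triangle_poly (n + 1) k (a - 1) (b - 1) c x y = J2 * Qb"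
    "triangle_poly (n + 1) (k + 1) (a - 1) (b - 1) c x y = J1 * jacobi_form (Suc k) c (b - 1) y (- z)"
    unfolding triangle J1_def J2_def Qb_def by (simp_all add: \<alpha>_def algebra_simps)

  have J2: "(real m + 1) * J2 = x * (\<alpha> * J) + (x - 1) * ((real m + a) * J1)"
    unfolding J_def J1_def J2_def by (rule jacobi_form_Suc_raise_left)
  have Qbc: "(real k + 1) * jacobi_form (Suc k) (c - 1) (b - 1) y (- z)
      = y * ((real k + c) * Qc) - z * ((real k + b) * Qb)"
    using jacobi_form_Suc_lower_both[of k c b y "- z"] by (simp add: Qb_def Qc_def)
  have yz: "y - - z = 1 - x"
    using assms(6) by simp
  have Qc2: "(real k + 1) * jacobi_form (Suc k) (c - 1) b y (- z)
      = (real k + c) * (1 - x) * Qc - \<alpha> * z * Q"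
    using jacobi_form_Suc_lower_left[of k c b y "- z"] unfolding yz \<alpha>_def Q_def Qc_def by algebra
  have Qb2: "(real k + 1) * jacobi_form (Suc k) c (b - 1) y (- z)
      = \<alpha> * y * Q - (real k + b) * (1 - x) * Qb"
    using jacobi_form_Suc_lower_right[of k c b y "- z"] unfolding yz \<alpha>_def Q_def Qb_def by algebra

  \<comment> \<open>The \<open>J1 * Qc\<close> terms cancel: \<open>J2\<close> brings the factor
    \<open>x - 1\<close> and \<open>Qc2\<close> the factor \<open>1 - x\<close>. Both surviving
    terms carry \<open>\<alpha>\<close>.\<close>
  have "- \<alpha> * Fx = X * (y * Y) * Z * ((real k + c) * (real m + 1) * (J2 * Qc)
      + (real k + 1) * (real m + a) * (J1 * jacobi_form (Suc k) (c - 1) b y (- z)))"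
    unfolding Fx_def J_diag Q_v using J2 Qc2 by algebra
  moreover have "Fy = - (real k + 1) * (x * X) * Y * Z * (J * jacobi_form (Suc k) (c - 1) (b - 1) y (- z))"
    unfolding Fy_def Q_p Q_v using Qbc by algebra
  \<comment> \<open>The \<open>Qc\<close> terms of \<open>Fy\<close> and \<open>Fx\<close> cancel
    since \<open>z\<close> is constant in this direction; the \<open>J1 * Qb\<close> terms then
    cancel as in the \<open>x\<close> case.\<close>
  moreover have "\<alpha> * (Fy - Fx) = X * Y * (z * Z) * ((real k + b) * (real m + 1) * (J2 * Qb)
      - (real k + 1) * (real m + a) * (J1 * jacobi_form (Suc k) c (b - 1) y (- z)))"
    unfolding Fx_def Fy_def J_diag Q_p Q_v using J2 Qb2 by algebra
  ultimately show ?thesis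
    unfolding partials Tx Ty Tz nk pows \<alpha>_def[symmetric] X_def[symmetric] Y_def[symmetric] Z_def[symmetric]
    using Fx Fy by (auto simp: real_differentiable_def)
qed

end
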